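(* Let $\rho>0$ and consider the Mallows culture on candidates $\{1,2,3\}$ with reference ranking $(3,2,1)$ and concentration parameter $\rho$, with $n$ independent voters. Then, as $n\to+\infty$, \[ 1-\mathbb{P}(3\text{ is the Condorcet winner})\sim\sqrt{\frac{2}{\pi n}}\;\frac{e^{-\rho\lceil n/2\rceil}}{1-e^{-\rho}}\left(\frac{2}{1+e^{-\rho}}\right)^n. \]
   Context: Mallows culture with reference ranking $r_0$ and parameter $\rho$: each voter independently draws ranking $r$ with probability $\gamma e^{-\rho d(r,r_0)}$, where $d$ is the Kendall tau distance (number of pairs of candidates ordered differently) and $\gamma$ normalizes. Candidate $3$ is the Condorcet winner if, for each $j\in\{1,2\}$, strictly more than $n/2$ voters rank $3$ above $j$. *)

theory Defs
  imports "HOL-Analysis.Analysis" "HOL-Combinatorics.Multiset_Permutations"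
          "HOL-Library.Landau_Symbols"
begin

text \<open>A ranking of the candidates {1,2,3} is a list enumerating them, best first.\<close>
definition candidates :: "nat set" where "candidates = {1,2,3}"

definition rankings :: "nat list set" where
  "rankings = permutations_of_set candidates"

definition above :: "nat list \<Rightarrow> nat \<Rightarrow> nat \<Rightarrow> bool" where
  "above r a b \<longleftrightarrow> (\<exists>i j. i < j \<and> j < length r \<and> r ! i = a \<and> r ! j = b)"

definition kendall_tau :: "nat list \<Rightarrow> nat list \<Rightarrow> nat" where
  "kendall_tau r s = card {(a,b). a \<in> candidates \<and> b \<in> candidates \<and> a < b \<and>
                                   (above r a b \<noteq> above s a b)}"

definition mallows :: "real \<Rightarrow> nat list \<Rightarrow> nat list \<Rightarrow> real" where
  "mallows rho r0 r =
     exp (- rho * real (kendall_tau r r0)) /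
     (\<Sum>s\<in>rankings. exp (- rho * real (kendall_tau s r0)))"

definition condorcet_winner3 :: "nat \<Rightarrow> (nat \<Rightarrow> nat list) \<Rightarrow> bool" where
  "condorcet_winner3 n p \<longleftrightarrow>
     (\<forall>j\<in>{1,2}. real (card {i. i < n \<and> above (p i) 3 j}) > real n / 2)"

definition prob_cw3 :: "real \<Rightarrow> nat \<Rightarrow> real" where
  "prob_cw3 rho n =
     (\<Sum>p\<in>PiE {..<n} (\<lambda>_. rankings).
        (if condorcet_winner3 n p then (\<Prod>i<n. mallows rho [3,2,1] (p i)) else 0))"

end

theory Submission
  imports Defs "HOL-Real_Asymp.Real_Asymp"
begin

text \<open>
  Put \<open>x = exp (- rho)\<close>. A voter ranks 2 above 3 with probability \<open>x / (1 + x)\<close> and 1 above 3 with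
  strictly smaller probability \<open>x\<^sup>2 (2 + x) / ((1 + x)(1 + x + x\<^sup>2))\<close>, both below one half. Candidate 3
  fails to be the Condorcet winner iff it fails to win a strict majority against 2 or against 1, so
  the failure probability lies between \<open>L 2\<close> and \<open>L 2 + L 1\<close>, where \<open>L j\<close> is the probability of
  failing against \<open>j\<close>. Here \<open>L 2\<close> is a binomial upper tail starting at \<open>m = \<lceil>n / 2\<rceil>\<close>, equal to
  \<open>(n choose m) x\<^sup>m / (1 + x)\<^sup>n\<close> times a sum that tends to \<open>\<Sum>j. x\<^sup>j\<close> by dominated convergence, and
  the central binomial coefficient is estimated by the Wallis product. Bounding each term of \<open>L 1\<close>
  by the one at \<open>n / 2\<close> shows that \<open>L 1\<close> is exponentially smaller than \<open>L 2\<close>, because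
  \<open>(1 + x + x\<^sup>2)\<^sup>2 - x (1 + 2 x) (2 + x) = (1 - x\<^sup>2)\<^sup>2 > 0\<close>.
\<close>

section \<open>Functions of a success count over independent voters\<close>

text \<open>A weighted binomial theorem, by induction on the voters. \<open>g\<close> must stay
  arbitrary because a further voter satisfying \<open>P\<close> shifts it to
  \<open>\<lambda>k. g (Suc k)\<close>; Pascal's rule then merges the two cases.\<close>

lemma sum_PiE_count:
  fixes w :: "'a \<Rightarrow> real" and g :: "nat \<Rightarrow> real"
  assumes "finite S"
  shows "(\<Sum>p\<in>PiE {..<n} (\<lambda>_. S). g (card {i. i < n \<and> P (p i)}) * (\<Prod>i<n. w (p i))) =
         (\<Sum>k\<le>n. real (n choose k) * sum w {r\<in>S. P r} ^ k * sum w {r\<in>S. \<not> P r} ^ (n - k) * g k)"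
proof (induction n arbitrary: g)
  case 0
  show ?case by simp
next
  case (Suc n)
  define a b where "a = sum w {r\<in>S. P r}" and "b = sum w {r\<in>S. \<not> P r}"
  define F where "F g = (\<Sum>p\<in>PiE {..<n} (\<lambda>_. S). g (card {i. i < n \<and> P (p i)}) * (\<Prod>i<n. w (p i)))"
    for g :: "nat \<Rightarrow> real"
  define h where "h k = real (n choose k) * a ^ k * b ^ (n - k)" for k
  have F: "F g = (\<Sum>k\<le>n. h k * g k)" for g
    unfolding F_def h_def a_def b_def by (rule Suc.IH)
  have card: "card {i. i < Suc n \<and> P ((p(n := y)) i)} = of_bool (P y) + card {i. i < n \<and> P (p i)}"
    for p y
  proof -
    have "{i. i < Suc n \<and> P ((p(n := y)) i)} = (if P y then {n} else {}) \<union> {i. i < n \<and> P (p i)}"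
      by (auto simp: less_Suc_eq)
    then show ?thesis by (simp add: card_insert_if)
  qed
  have prod: "(\<Prod>i<Suc n. w ((p(n := y)) i)) = w y * (\<Prod>i<n. w (p i))" for p y
    by (simp add: mult.commute)
  \<comment> \<open>The last voter is split off: each profile is \<open>p(n := y)\<close> for a
    unique pair \<open>(y, p)\<close>.\<close>
  have "(\<Sum>p\<in>PiE {..<Suc n} (\<lambda>_. S).
          g (card {i. i < Suc n \<and> P (p i)}) * (\<Prod>i<Suc n. w (p i)))
      = (\<Sum>(y, p)\<in>S \<times> PiE {..<n} (\<lambda>_. S).
          g (of_bool (P y) + card {i. i < n \<and> P (p i)}) * (w y * (\<Prod>i<n. w (p i))))"
    unfolding lessThan_Suc[of n, THEN arg_cong, of "\<lambda>A. PiE A (\<lambda>_. S)"] PiE_insert_eq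
    using inj_combinator[of n "{..<n}" "\<lambda>_. S"]
    by (subst sum.reindex) (simp_all only: lessThan_iff less_irrefl not_False_eq_True
          comp_def case_prod_unfold fst_conv snd_conv card prod)
  also have "\<dots> = (\<Sum>y\<in>S. w y * F (\<lambda>k. g (of_bool (P y) + k)))"
    unfolding F_def sum.cartesian_product[symmetric]
    by (simp add: sum_distrib_left mult_ac)
  also have "\<dots> = (\<Sum>y\<in>S. if P y then w y * F (\<lambda>k. g (Suc k)) else w y * F g)"
    by (intro sum.cong) auto
  also have "\<dots> = a * F (\<lambda>k. g (Suc k)) + b * F g"
    using assms by (simp add: sum.If_cases a_def b_def sum_distrib_right Int_def)
  \<comment> \<open>The second sum may run up to \<open>Suc n\<close> because
    \<open>h (Suc n) = 0\<close>, which prepares the index shift.\<close>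
  also have "\<dots> = (\<Sum>k\<le>n. a * h k * g (Suc k)) + (\<Sum>k\<le>Suc n. b * h k * g k)"
    by (simp add: F sum_distrib_left mult_ac) (simp add: h_def)
  also have "\<dots> = b * h 0 * g 0 + (\<Sum>k\<le>n. (a * h k + b * h (Suc k)) * g (Suc k))"
    by (simp add: sum.atMost_Suc_shift algebra_simps sum.distrib del: sum.atMost_Suc)
  also have "\<dots> = (\<Sum>k\<le>Suc n. real (Suc n choose k) * a ^ k * b ^ (Suc n - k) * g k)"
  proof -
    have "a * h k + b * h (Suc k) = real (Suc n choose Suc k) * a ^ Suc k * b ^ (n - k)"
      if "k \<le> n" for k
    \<comment> \<open>At \<open>k = n\<close> the exponent \<open>n - Suc k\<close> truncates to 0,
      so the power rule for \<open>b\<close> fails there; instead \<open>h (Suc k)\<close>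
      vanishes.\<close>
    proof (cases "k = n")
      case False
      then have "b ^ (n - k) = b * b ^ (n - Suc k)"
        using that by (metis Suc_diff_Suc le_neq_implies_less power_Suc)
      then show ?thesis by (simp add: h_def algebra_simps)
    qed (simp add: h_def)
    then show ?thesis
      unfolding sum.atMost_Suc_shift by (simp add: h_def)
  qed
  finally show ?case by (simp add: a_def b_def)
qed

section \<open>Central binomial coefficients\<close>

text \<open>Brings Wallis' product into binomial form. Passing from m to m+1 multiplies the central
  coefficient by 2(2m+1)/(m+1), obtained from two absorption identities with a reflection in
  between.\<close>

lemma wallis_prod_eq:
  "(\<Prod>k=1..m. (4*real k^2) / (4*real k^2 - 1)) = (4^m / real (2*m choose m))^2 / real (2*m+1)"
proof (induction m)
  case (Suc m)
  have pos: "real (2*m choose m) > 0" by simp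
  have "Suc m * (2 * Suc m choose Suc m) = 2 * (2*m+1) * (2*m choose m)"
  proof -
    have "Suc m * (2 * Suc m choose Suc m) = 2 * Suc m * (Suc (2*m) choose m)"
      using Suc_times_binomial_eq[of "Suc (2*m)" m] by (simp add: mult.commute)
    also have "Suc (2*m) choose m = Suc (2*m) choose Suc m"
      using binomial_symmetric[of m "Suc (2*m)"] by (simp add: Suc_diff_le)
    also have "2 * Suc m * (Suc (2*m) choose Suc m) = 2 * (2*m+1) * (2*m choose m)"
      using Suc_times_binomial_eq[of "2*m" m] by (simp add: mult_ac del: binomial_Suc_Suc)
    finally show ?thesis .
  qed
  then have "real (Suc m) * real (2 * Suc m choose Suc m) = 2 * real (2*m+1) * real (2*m choose m)"
    by (metis of_nat_mult of_nat_numeral)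
  then have eq: "real (2 * Suc m choose Suc m) = 2 * real (2*m+1) * real (2*m choose m) / real (Suc m)"
    by (simp add: field_simps)
  have "4*real (Suc m)^2 - 1 = real (2*m+1) * real (2*m+3)"
    by (simp add: algebra_simps power2_eq_square)
  then have "(\<Prod>k=1..Suc m. (4*real k^2) / (4*real k^2 - 1)) =
     (4^m / real (2*m choose m))^2 / real (2*m+1) * (4*real (Suc m)^2 / (real (2*m+1) * real (2*m+3)))"
    using Suc.IH by (simp add: mult.commute)
  also have "\<dots> = (4^Suc m / real (2 * Suc m choose Suc m))^2 / real (2*Suc m+1)"
    unfolding eq using pos by (simp add: divide_simps power2_eq_square) (simp add: algebra_simps)
  finally show ?case .
qed simp

lemma central_binomial_limit:
  "(\<lambda>m. sqrt (real (2*m+1)) * real (2*m choose m) / 4^m) \<longlonglongrightarrow> sqrt (2 / pi)"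
proof -
  have "(\<lambda>m. sqrt (inverse (\<Prod>k=1..m. (4*real k^2) / (4*real k^2 - 1)))) \<longlonglongrightarrow> sqrt (inverse (pi / 2))"
    by (intro tendsto_real_sqrt tendsto_inverse wallis) simp
  moreover have "sqrt (inverse (\<Prod>k=1..m. (4*real k^2) / (4*real k^2 - 1))) =
      sqrt (real (2*m+1)) * real (2*m choose m) / 4^m" for m
    unfolding wallis_prod_eq by (simp add: real_sqrt_mult real_sqrt_divide inverse_eq_divide)
  ultimately show ?thesis by simp
qed

text \<open>Both parities reduce to the central case: with m = \<lceil>n/2\<rceil>, an odd n is
  2m-1, and the coefficient of 2m choose m is twice that of n choose m, which matches the extra
  factor 2 in 4^m.\<close>

lemma middle_binomial_limit:
  "(\<lambda>n. sqrt (real n) * real (n choose ((n+1) div 2)) / 2^n) \<longlonglongrightarrow> sqrt (2 / pi)"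
proof -
  define m where "m n = (n+1) div 2" for n :: nat
  have eq: "real (n choose m n) / 2^n = real (2*m n choose m n) / 4^m n" for n
  proof (cases "even n")
    case True
    then obtain k where "n = 2*k" by blast
    then show ?thesis by (simp add: m_def power_mult)
  next
    case False
    then obtain k where k: "n = 2*k+1" by (elim oddE)
    have "2 * (k+1) choose (k+1) = (2*k+1 choose k) + (2*k+1 choose (k+1))" by simp
    also have "2*k+1 choose k = 2*k+1 choose (k+1)"
      using binomial_symmetric[of k "2*k+1"] by (simp add: Suc_diff_le)
    finally have "real (2 * (k+1) choose (k+1)) = 2 * real (2*k+1 choose (k+1))" by linarith
    then show ?thesis by (simp add: m_def k power_mult del: binomial_Suc_Suc)
  qed
  have "filterlim m at_top sequentially"
    unfolding m_def
    by (rule filterlim_compose[OF filterlim_at_top_div_const_nat filterlim_add_const_nat_at_top]) simp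
  then have "(\<lambda>n. sqrt (real (2*m n+1)) * real (2*m n choose m n) / 4^m n) \<longlonglongrightarrow> sqrt (2 / pi)"
    by (rule filterlim_compose[OF central_binomial_limit])
  moreover have "(\<lambda>n. sqrt (real n / real (2*m n+1))) \<longlonglongrightarrow> sqrt 1"
  proof (intro tendsto_real_sqrt, rule tendsto_sandwich)
    \<comment> \<open>\<open>2*m n+1\<close> is n+1 or n+2, according to parity.\<close>
    show "\<forall>\<^sub>F n in sequentially. real n / (real n + 2) \<le> real n / real (2*m n+1)"
      by (intro always_eventually allI divide_left_mono) (auto simp: m_def)
    show "\<forall>\<^sub>F n in sequentially. real n / real (2*m n+1) \<le> 1"
      by (intro always_eventually allI) (auto simp: m_def divide_simps)
    show "(\<lambda>n. real n / (real n + 2)) \<longlonglongrightarrow> 1" by real_asymp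
  qed simp
  ultimately have "(\<lambda>n. sqrt (real (2*m n+1)) * real (2*m n choose m n) / 4^m n *
      sqrt (real n / real (2*m n+1))) \<longlonglongrightarrow> sqrt (2 / pi) * sqrt 1"
    by (rule tendsto_mult)
  moreover have "sqrt (real (2*m n+1)) * real (2*m n choose m n) / 4^m n * sqrt (real n / real (2*m n+1))
     = sqrt (real n) * real (n choose m n) / 2^n" for n
    using eq[of n] by (simp add: real_sqrt_divide divide_simps)
  ultimately show ?thesis by (simp add: m_def)
qed

section \<open>The binomial upper tail\<close>

text \<open>Near the middle, neighbouring coefficients have quotient (n-m-j)/(m+j+1), which tends to
  1 for fixed j; a fixed number of such quotients is multiplied.\<close>

lemma binomial_shift_ratio_limit:
  "(\<lambda>n. real (n choose ((n+1) div 2 + j)) / real (n choose ((n+1) div 2))) \<longlonglongrightarrow> 1"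
proof (induction j)
  case 0
  have "(n choose ((n+1) div 2)) \<noteq> 0" for n by (simp add: not_less)
  then show ?case by simp
next
  case (Suc j)
  define m where "m n = (n+1) div 2" for n :: nat
  have "(\<lambda>n. real (n - (m n + j)) / real (Suc (m n + j))) \<longlonglongrightarrow> 1"
  proof (rule tendsto_sandwich)
    show "\<forall>\<^sub>F n in sequentially. (real n / 2 - 1 - real j) / (real n / 2 + 2 + real j)
        \<le> real (n - (m n + j)) / real (Suc (m n + j))"
      \<comment> \<open>From this threshold on, \<open>m n + j \<le> n\<close>, so the natural
        subtraction is exact and the numerator nonnegative.\<close>
      using eventually_ge_at_top[of "2*j+4"]
    proof eventually_elim
      case (elim n)
      have m: "real n \<le> 2 * real (m n)" "2 * real (m n) \<le> real n + 1" by (auto simp: m_def)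
      have "m n + j \<le> n" using elim by (auto simp: m_def)
      then have r: "real (n - (m n + j)) = real n - real (m n) - real j" by simp
      have "real n \<ge> 2 * real j + 4" using elim by linarith
      then show ?case unfolding r using m by (intro frac_le) auto
    qed
    show "\<forall>\<^sub>F n in sequentially. real (n - (m n + j)) / real (Suc (m n + j)) \<le> 1"
      by (intro always_eventually allI) (auto simp: m_def divide_simps)
    show "(\<lambda>n. (real n / 2 - 1 - real j) / (real n / 2 + 2 + real j)) \<longlonglongrightarrow> 1"
      by real_asymp
  qed simp
  with Suc.IH have "(\<lambda>n. real (n choose (m n + j)) / real (n choose (m n)) *
      (real (n - (m n + j)) / real (Suc (m n + j)))) \<longlonglongrightarrow> 1 * 1"
    unfolding m_def by (intro tendsto_mult)
  moreover have "real (n choose (m n + j)) / real (n choose (m n)) * (real (n - (m n + j)) / real (Suc (m n + j)))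
      = real (n choose (m n + Suc j)) / real (n choose (m n))" for n
  proof -
    have "Suc (m n + j) * (n choose Suc (m n + j)) = (n - (m n + j)) * (n choose (m n + j))"
      by (rule binomial_absorb_comp[of n "m n + j", folded binomial_absorption, symmetric])
    then have "real (Suc (m n + j)) * real (n choose Suc (m n + j)) = real (n - (m n + j)) * real (n choose (m n + j))"
      by (metis of_nat_mult)
    then have "real (n choose Suc (m n + j)) = real (n - (m n + j)) * real (n choose (m n + j)) / real (Suc (m n + j))"
      by (simp add: field_simps)
    then show ?thesis by (simp add: mult_ac)
  qed
  ultimately show ?case by (simp add: m_def)
qed

lemma binomial_tail_limit:
  fixes x :: real
  assumes "0 < x" "x < 1"
  shows "(\<lambda>n. (\<Sum>k\<in>{(n+1) div 2..n}. real (n choose k) * x ^ k) /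
           (real (n choose ((n+1) div 2)) * x ^ ((n+1) div 2))) \<longlonglongrightarrow> 1 / (1 - x)"
proof -
  define m where "m n = (n+1) div 2" for n :: nat
  define a where "a j n = real (n choose (m n + j)) / real (n choose m n) * x ^ j" for j n
  \<comment> \<open>Coefficients decrease to the right of the middle; this makes the geometric
    series a dominating series.\<close>
  have le: "n choose (m n + j) \<le> n choose m n" for n j
  proof (cases "m n + j \<le> n")
    case True
    then show ?thesis by (intro binomial_antimono) (auto simp: m_def)
  qed (simp add: binomial_eq_0)
  have pos: "real (n choose m n) > 0" for n by (simp add: m_def)
  have "(\<lambda>n. \<Sum>j. a j n) \<longlonglongrightarrow> (\<Sum>j. x ^ j)"
  proof (rule tannerys_theorem[THEN conjunct2, THEN conjunct2])
    show "(\<lambda>n. a j n) \<longlonglongrightarrow> x ^ j" for j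
      using tendsto_mult[OF binomial_shift_ratio_limit[of j] tendsto_const[of "x ^ j"]]
      by (simp add: a_def m_def)
    show "\<forall>\<^sub>F (j, n) in at_top \<times>\<^sub>F sequentially. norm (a j n) \<le> x ^ j"
      using le pos assms by (intro always_eventually) (auto simp: a_def divide_simps mult_right_mono)
    show "summable (\<lambda>j. x ^ j)" using assms by (intro summable_geometric) auto
  qed simp
  also have "(\<Sum>j. x ^ j) = 1 / (1 - x)" using assms by (intro suminf_geometric) auto
  also have "(\<lambda>n. \<Sum>j. a j n) =
      (\<lambda>n. (\<Sum>k\<in>{m n..n}. real (n choose k) * x ^ k) / (real (n choose m n) * x ^ m n))"
  proof
    fix n
    have "m n \<le> n" by (auto simp: m_def)
    \<comment> \<open>The series is finite, since \<open>n choose (m n + j)\<close> is 0 once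
      \<open>m n + j\<close> exceeds n.\<close>
    have "(\<Sum>j. a j n) = (\<Sum>j\<in>{0..n - m n}. a j n)"
      by (rule suminf_finite) (auto simp: a_def binomial_eq_0)
    also have "\<dots> = (\<Sum>k\<in>{m n..n}. a (k - m n) n)"
      using sum.shift_bounds_cl_nat_ivl[of "\<lambda>k. a (k - m n) n" 0 "m n" "n - m n"] \<open>m n \<le> n\<close> by simp
    also have "\<dots> = (\<Sum>k\<in>{m n..n}. real (n choose k) * x ^ k / (real (n choose m n) * x ^ m n))"
      using assms by (intro sum.cong) (auto simp: a_def power_diff)
    finally show "(\<Sum>j. a j n) =
      (\<Sum>k\<in>{m n..n}. real (n choose k) * x ^ k) / (real (n choose m n) * x ^ m n)"
      by (simp add: sum_divide_distrib)
  qed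
  finally show ?thesis by (simp add: m_def)
qed

section \<open>The six rankings and their Mallows weights\<close>

lemma rankings_eq:
  "rankings = {[1,2,3], [1,3,2], [2,1,3], [2,3,1], [3,1,2], [3,2,1]}"
  unfolding rankings_def candidates_def
  by (subst permutations_of_set_nonempty) (auto simp: insert_Diff_if permutations_of_set_doubleton)

text \<open>Replaces the quantified positions by a disjunction that the simplifier can decide on
  each explicit ranking.\<close>

lemma above_three:
  "above [a,b,c] u v \<longleftrightarrow> a = u \<and> b = v \<or> a = u \<and> c = v \<or> b = u \<and> c = v"
proof -
  have "(\<exists>i j. i < j \<and> j < (3::nat) \<and> Q i j) \<longleftrightarrow> Q 0 1 \<or> Q 0 2 \<or> Q 1 2" for Q
  proof
    assume "\<exists>i j. i < j \<and> j < (3::nat) \<and> Q i j"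
    then obtain i j where ij: "i < j" "j < (3::nat)" "Q i j" by blast
    then have "i = 0 \<and> j = 1 \<or> i = 0 \<and> j = 2 \<or> i = 1 \<and> j = 2" by linarith
    with ij show "Q 0 1 \<or> Q 0 2 \<or> Q 1 2" by blast
  next
    assume "Q 0 1 \<or> Q 0 2 \<or> Q 1 2"
    moreover have "0 < (1::nat)" "0 < (2::nat)" "1 < (2::nat)" "1 < (3::nat)" "2 < (3::nat)" by auto
    ultimately show "\<exists>i j. i < j \<and> j < (3::nat) \<and> Q i j" by blast
  qed
  from this[of "\<lambda>i j. [a,b,c] ! i = u \<and> [a,b,c] ! j = v"]
  show ?thesis by (simp add: above_def numeral_3_eq_3)
qed

lemma kendall_tau_eq:
  "kendall_tau r s = of_bool (above r 1 2 \<noteq> above s 1 2) + of_bool (above r 1 3 \<noteq> above s 1 3)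
     + of_bool (above r 2 3 \<noteq> above s 2 3)"
proof -
  have "{(a,b). a \<in> candidates \<and> b \<in> candidates \<and> a < b \<and> (above r a b \<noteq> above s a b)} =
     {(1,2), (1,3), (2,3)} \<inter> {(a,b). above r a b \<noteq> above s a b}"
    by (auto simp: candidates_def)
  then show ?thesis unfolding kendall_tau_def by (simp add: Int_insert_left)
qed

text \<open>The six distances to the reference are 0, 1, 1, 2, 2, 3, so the normalizer is 1 + 2x +
  2x^2 + x^3, which factors.\<close>

lemma mallows_321:
  fixes rho :: real
  defines "x \<equiv> exp (- rho)"
  shows "mallows rho [3,2,1] r = x ^ kendall_tau r [3,2,1] / ((1 + x) * (1 + x + x^2))"
proof -
  have e: "exp (- rho * real k) = x ^ k" for k
    by (simp add: x_def exp_of_nat_mult[symmetric] mult.commute)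
  have "(\<Sum>s\<in>rankings. x ^ kendall_tau s [3,2,1]) = (1 + x) * (1 + x + x^2)"
    by (simp add: rankings_eq kendall_tau_eq above_three) (simp add: algebra_simps power2_eq_square power3_eq_cube)
  then show ?thesis unfolding mallows_def e by simp
qed

section \<open>Failing against a single opponent\<close>

text \<open>The weak inequality makes a tie count as a failure, as the strict majority
  demands.\<close>

definition loss_prob :: "real \<Rightarrow> nat \<Rightarrow> nat \<Rightarrow> real" where
  "loss_prob rho j n = (\<Sum>p\<in>PiE {..<n} (\<lambda>_. rankings).
     of_bool (2 * card {i. i < n \<and> above (p i) 3 j} \<le> n) * (\<Prod>i<n. mallows rho [3,2,1] (p i)))"

lemma finite_rankings: "finite rankings"
  by (simp add: rankings_eq)

lemma mallows_nonneg: "mallows rho r0 r \<ge> 0"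
  unfolding mallows_def by (intro divide_nonneg_nonneg sum_nonneg) auto

lemma sum_mallows: "(\<Sum>r\<in>rankings. mallows rho r0 r) = 1"
proof -
  have "(\<Sum>s\<in>rankings. exp (- rho * real (kendall_tau s r0))) > 0"
    by (intro sum_pos finite_rankings) (auto simp: rankings_eq)
  then show ?thesis unfolding mallows_def by (simp flip: sum_divide_distrib)
qed

lemma one_minus_prob_cw3_bounds:
  "loss_prob rho 2 n \<le> 1 - prob_cw3 rho n"
  "1 - prob_cw3 rho n \<le> loss_prob rho 2 n + loss_prob rho 1 n"
proof -
  define V where "V = PiE {..<n} (\<lambda>_. rankings)"
  define W where "W p = (\<Prod>i<n. mallows rho [3,2,1] (p i))" for p
  define B where "B j p \<longleftrightarrow> 2 * card {i. i < n \<and> above (p i) 3 j} \<le> n" for j p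
  have W: "W p \<ge> 0" for p unfolding W_def by (intro prod_nonneg ballI mallows_nonneg)
  have "(\<Sum>p\<in>V. W p) = (\<Prod>i<n. \<Sum>r\<in>rankings. mallows rho [3,2,1] r)"
    unfolding V_def W_def by (rule prod_sum_PiE[symmetric]) (auto simp: finite_rankings)
  then have one: "(\<Sum>p\<in>V. W p) = 1" by (simp add: sum_mallows)
  have cw: "condorcet_winner3 n p \<longleftrightarrow> \<not> B 1 p \<and> \<not> B 2 p" for p
    unfolding condorcet_winner3_def B_def by auto
  have "1 - prob_cw3 rho n = (\<Sum>p\<in>V. W p) - (\<Sum>p\<in>V. if condorcet_winner3 n p then W p else 0)"
    unfolding one unfolding prob_cw3_def V_def W_def ..
  also have "\<dots> = (\<Sum>p\<in>V. of_bool (B 1 p \<or> B 2 p) * W p)"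
    by (subst sum_subtractf[symmetric]) (intro sum.cong, auto simp: cw)
  finally have eq: "1 - prob_cw3 rho n = (\<Sum>p\<in>V. of_bool (B 1 p \<or> B 2 p) * W p)" .
  have L: "loss_prob rho j n = (\<Sum>p\<in>V. of_bool (B j p) * W p)" for j
    by (simp add: loss_prob_def V_def W_def B_def)
  show "loss_prob rho 2 n \<le> 1 - prob_cw3 rho n"
    unfolding eq L by (intro sum_mono mult_right_mono W) auto
  show "1 - prob_cw3 rho n \<le> loss_prob rho 2 n + loss_prob rho 1 n"
    unfolding eq L sum.distrib[symmetric] distrib_right[symmetric]
    by (intro sum_mono mult_right_mono W) auto
qed

lemma loss_prob_binomial:
  "loss_prob rho j n = (\<Sum>k\<le>n. real (n choose k) *
     (\<Sum>r | r \<in> rankings \<and> above r 3 j. mallows rho [3,2,1] r) ^ k *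
     (\<Sum>r | r \<in> rankings \<and> \<not> above r 3 j. mallows rho [3,2,1] r) ^ (n - k) * of_bool (2 * k \<le> n))"
  unfolding loss_prob_def
  by (rule sum_PiE_count[OF finite_rankings, where g = "\<lambda>k. of_bool (2 * k \<le> n)"])

text \<open>Since 3 and 2 are adjacent in the reference, the distances are 0, 1, 2 on one side and
  1, 2, 3 on the other, and 1 + x + x^2 cancels. Against 1 they are 0, 1, 1 and 2, 2, 3, without
  this factor.\<close>

lemma mallows_marginals:
  fixes rho :: real
  defines "x \<equiv> exp (- rho)"
  shows "(\<Sum>r | r \<in> rankings \<and> above r 3 2. mallows rho [3,2,1] r) = 1 / (1 + x)"
    and "(\<Sum>r | r \<in> rankings \<and> \<not> above r 3 2. mallows rho [3,2,1] r) = x / (1 + x)"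
    and "(\<Sum>r | r \<in> rankings \<and> above r 3 1. mallows rho [3,2,1] r) =
           (1 + 2 * x) / ((1 + x) * (1 + x + x^2))"
    and "(\<Sum>r | r \<in> rankings \<and> \<not> above r 3 1. mallows rho [3,2,1] r) =
           x^2 * (2 + x) / ((1 + x) * (1 + x + x^2))"
proof -
  have x: "x > 0" by (simp add: x_def)
  have nz: "1 + x \<noteq> 0" "1 + x + x^2 \<noteq> 0" using x by (auto simp: add_pos_pos less_imp_neq[symmetric])
  have sets:
    "{r. r \<in> rankings \<and> above r 3 2} = {[1,3,2], [3,1,2], [3,2,1]}"
    "{r. r \<in> rankings \<and> \<not> above r 3 2} = {[1,2,3], [2,1,3], [2,3,1]}"
    "{r. r \<in> rankings \<and> above r 3 1} = {[2,3,1], [3,1,2], [3,2,1]}"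
    "{r. r \<in> rankings \<and> \<not> above r 3 1} = {[1,2,3], [1,3,2], [2,1,3]}"
    by (auto simp: rankings_eq above_three)
  note weights = sets mallows_321[of rho, folded x_def] kendall_tau_eq
  show "(\<Sum>r | r \<in> rankings \<and> above r 3 2. mallows rho [3,2,1] r) = 1 / (1 + x)"
    unfolding weights using nz
    by (simp add: above_three) (simp add: divide_simps, simp add: algebra_simps power2_eq_square)
  show "(\<Sum>r | r \<in> rankings \<and> \<not> above r 3 2. mallows rho [3,2,1] r) = x / (1 + x)"
    unfolding weights using nz
    by (simp add: above_three) (simp add: divide_simps, simp add: algebra_simps power2_eq_square power3_eq_cube)
  show "(\<Sum>r | r \<in> rankings \<and> above r 3 1. mallows rho [3,2,1] r) =
           (1 + 2 * x) / ((1 + x) * (1 + x + x^2))"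
    unfolding weights by (simp add: above_three add_divide_distrib)
  show "(\<Sum>r | r \<in> rankings \<and> \<not> above r 3 1. mallows rho [3,2,1] r) =
           x^2 * (2 + x) / ((1 + x) * (1 + x + x^2))"
    unfolding weights
    by (simp add: above_three add_divide_distrib[symmetric])
       (simp add: algebra_simps power2_eq_square power3_eq_cube)
qed

lemma loss_prob_2:
  fixes rho :: real
  defines "x \<equiv> exp (- rho)"
  shows "loss_prob rho 2 n = (\<Sum>k\<in>{(n+1) div 2..n}. real (n choose k) * x ^ k) / (1 + x) ^ n"
proof -
  have x: "x > 0" by (simp add: x_def)
  have "loss_prob rho 2 n =
      (\<Sum>k\<le>n. real (n choose k) * (1 / (1 + x)) ^ k * (x / (1 + x)) ^ (n - k) * of_bool (2 * k \<le> n))"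
    unfolding loss_prob_binomial mallows_marginals x_def ..
  also have "\<dots> = (\<Sum>k\<le>n. of_bool (2 * k \<le> n) * (real (n choose k) * x ^ (n - k) / (1 + x) ^ n))"
  proof (intro sum.cong refl)
    fix k assume "k \<in> {..n}"
    then have "(1 + x) ^ n = (1 + x) ^ k * (1 + x) ^ (n - k)" by (simp flip: power_add)
    then show "real (n choose k) * (1 / (1 + x)) ^ k * (x / (1 + x)) ^ (n - k) * of_bool (2 * k \<le> n)
       = of_bool (2 * k \<le> n) * (real (n choose k) * x ^ (n - k) / (1 + x) ^ n)"
      by (simp add: power_divide)
  qed
  \<comment> \<open>Reflection: k now counts the voters with 2 above 3, and failure reads
    \<open>n \<le> 2 * k\<close>.\<close>
  also have "\<dots> = (\<Sum>k\<le>n. of_bool (2 * (n - k) \<le> n) * (real (n choose (n - k)) * x ^ (n - (n - k)) / (1 + x) ^ n))"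
    by (rule sum.reindex_bij_witness[of _ "\<lambda>k. n - k" "\<lambda>k. n - k"]) auto
  also have "\<dots> = (\<Sum>k\<le>n. of_bool (n \<le> 2 * k) * (real (n choose k) * x ^ k / (1 + x) ^ n))"
    by (intro sum.cong refl arg_cong2[where f = "(*)"]) (auto simp flip: binomial_symmetric)
  also have "\<dots> = (\<Sum>k\<in>{(n+1) div 2..n}. real (n choose k) * x ^ k / (1 + x) ^ n)"
    by (rule sum.mono_neutral_cong_right) auto
  finally show ?thesis by (simp add: sum_divide_distrib)
qed

text \<open>With c the geometric mean of a and b, and b \<le> c, every term with 2k \<le> n
  satisfies a^k b^(n-k) = (ab)^k b^(n-2k) \<le> c^n; the binomial coefficients add up to at most
  2^n.\<close>

lemma loss_prob_1_le:
  fixes rho :: real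
  defines "x \<equiv> exp (- rho)"
  assumes "rho > 0"
  shows "loss_prob rho 1 n \<le>
    (2 * sqrt (x^2 * (1 + 2 * x) * (2 + x)) / ((1 + x) * (1 + x + x^2))) ^ n"
proof -
  define a where "a = (1 + 2 * x) / ((1 + x) * (1 + x + x^2))"
  define b where "b = x^2 * (2 + x) / ((1 + x) * (1 + x + x^2))"
  define c where "c = sqrt (a * b)"
  have x: "0 < x" "x < 1" using assms by (auto simp: x_def)
  then have Z: "(1 + x) * (1 + x + x^2) > 0" by (intro mult_pos_pos add_pos_pos) auto
  have "x^2 \<le> 1" and "x^2 \<le> x"
    using x power_decreasing[of 1 2 x] by (simp_all add: power_le_one)
  moreover have "x^2 * x \<le> 1 * x"
    using x by (intro mult_right_mono power_le_one) auto
  moreover have "x^2 * (2 + x) = x^2 + x^2 + x^2 * x" by (simp add: algebra_simps)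
  ultimately have "x^2 * (2 + x) \<le> 1 + 2 * x" by linarith
  then have "b \<le> a" using Z by (simp add: a_def b_def divide_right_mono)
  have "0 \<le> b" using Z x by (auto simp: b_def)
  have c: "0 \<le> c" "b \<le> c" "c\<^sup>2 = a * b"
    using \<open>b \<le> a\<close> \<open>0 \<le> b\<close> by (auto simp: c_def real_le_rsqrt power2_eq_square mult_right_mono)
  have bound: "a ^ k * b ^ (n - k) \<le> c ^ n" if "2 * k \<le> n" for k
  proof -
    have "a ^ k * b ^ (n - k) = (a * b) ^ k * b ^ (n - 2 * k)"
      using that by (simp add: power_mult_distrib mult.assoc flip: power_add)
    also have "\<dots> \<le> (c\<^sup>2) ^ k * c ^ (n - 2 * k)"
      unfolding c(3)[symmetric] using c(1,2) \<open>0 \<le> b\<close> by (intro mult_left_mono power_mono) auto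
    also have "\<dots> = c ^ n" using that by (simp flip: power_mult power_add)
    finally show ?thesis .
  qed
  have "loss_prob rho 1 n = (\<Sum>k\<le>n. real (n choose k) * a ^ k * b ^ (n - k) * of_bool (2 * k \<le> n))"
    unfolding loss_prob_binomial mallows_marginals x_def a_def b_def ..
  also have "\<dots> \<le> (\<Sum>k\<le>n. real (n choose k) * c ^ n)"
    using bound c(1) by (intro sum_mono) (auto simp: mult.assoc intro!: mult_left_mono)
  also have "\<dots> = 2 ^ n * c ^ n"
    by (simp flip: sum_distrib_right of_nat_sum add: choose_row_sum)
  also have "c = sqrt (x^2 * (1 + 2 * x) * (2 + x)) / ((1 + x) * (1 + x + x^2))"
  proof -
    have "a * b = x^2 * (1 + 2 * x) * (2 + x) / ((1 + x) * (1 + x + x^2))^2"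
      by (simp add: a_def b_def power2_eq_square)
    then show ?thesis using Z by (simp add: c_def real_sqrt_divide)
  qed
  finally show ?thesis by (simp flip: power_mult_distrib)
qed

section \<open>The asymptotic equivalence\<close>

theorem theorem9:
  fixes rho :: real
  assumes "rho > 0"
  shows "(\<lambda>n. 1 - prob_cw3 rho n) \<sim>[at_top]
         (\<lambda>n. sqrt (2 / (pi * real n)) * exp (- rho * real_of_int \<lceil>real n / 2\<rceil>)
               / (1 - exp (- rho)) * (2 / (1 + exp (- rho))) ^ n)"
proof -
  define x where "x = exp (- rho)"
  define m where "m n = (n+1) div 2" for n :: nat
  define g where "g n = sqrt (2 / (pi * real n)) * exp (- rho * real_of_int \<lceil>real n / 2\<rceil>)
               / (1 - exp (- rho)) * (2 / (1 + exp (- rho))) ^ n" for n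
  \<comment> \<open>The quotient of exponential rates: that of \<open>loss_prob_1_le\<close> divided
    by 2 sqrt(x)/(1+x), the rate of \<open>g\<close>.\<close>
  define theta where "theta = sqrt (x * (1 + 2 * x) * (2 + x)) / (1 + x + x^2)"
  have x: "0 < x" "x < 1" using assms by (auto simp: x_def)
  have ceil: "\<lceil>real n / 2\<rceil> = int (m n)" for n
    by (rule ceiling_unique) (auto simp: m_def field_simps)
  have "exp (- rho * real k) = x ^ k" for k
    by (simp add: x_def exp_of_nat_mult[symmetric] mult.commute)
  then have g: "g n = sqrt (2 / pi) * x ^ m n * 2 ^ n / (sqrt (real n) * (1 - x) * (1 + x) ^ n)" for n
    unfolding g_def ceil by (simp add: x_def[symmetric] real_sqrt_divide real_sqrt_mult power_divide)
  have gpos: "g n > 0" if "n > 0" for n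
    unfolding g using x that by simp

  have "(\<lambda>n. loss_prob rho 2 n / g n) \<longlonglongrightarrow> 1"
  proof (rule Lim_transform_eventually)
    show "(\<lambda>n. (sqrt (real n) * real (n choose m n) / 2^n) *
        ((\<Sum>k\<in>{m n..n}. real (n choose k) * x ^ k) / (real (n choose m n) * x ^ m n)) *
        ((1 - x) / sqrt (2 / pi))) \<longlonglongrightarrow> 1"
      using tendsto_mult[OF tendsto_mult[OF middle_binomial_limit binomial_tail_limit[OF x]]
          tendsto_const[of "(1 - x) / sqrt (2 / pi)"]] x
      by (simp add: m_def)
    show "\<forall>\<^sub>F n in sequentially. (sqrt (real n) * real (n choose m n) / 2^n) *
        ((\<Sum>k\<in>{m n..n}. real (n choose k) * x ^ k) / (real (n choose m n) * x ^ m n)) *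
        ((1 - x) / sqrt (2 / pi)) = loss_prob rho 2 n / g n"
    \<comment> \<open>This includes n = 0, where both sides are 0 because \<open>g 0 = 0\<close> and
      division by zero gives 0.\<close>
    proof (intro always_eventually allI)
      fix n
      have "real (n choose m n) > 0" by (simp add: m_def)
      then show "(sqrt (real n) * real (n choose m n) / 2^n) *
        ((\<Sum>k\<in>{m n..n}. real (n choose k) * x ^ k) / (real (n choose m n) * x ^ m n)) *
        ((1 - x) / sqrt (2 / pi)) = loss_prob rho 2 n / g n"
        unfolding loss_prob_2 g x_def[symmetric] m_def[symmetric] using x
        by (simp add: mult_ac)
    qed
  qed
  moreover have "(\<lambda>n. loss_prob rho 1 n / g n) \<longlonglongrightarrow> 0"
  proof (rule tendsto_sandwich)
    have "loss_prob rho 1 n \<ge> 0" for n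
      unfolding loss_prob_def by (intro sum_nonneg mult_nonneg_nonneg prod_nonneg ballI mallows_nonneg) auto
    then have "0 \<le> loss_prob rho 1 n / g n" if "n > 0" for n
      using gpos[OF that] by simp
    then show "\<forall>\<^sub>F n in sequentially. 0 \<le> loss_prob rho 1 n / g n"
      by (rule eventually_mono[OF eventually_gt_at_top[of 0]])
    have "theta < 1"
    proof -
      have "(1 + x + x^2)^2 - x * (1 + 2 * x) * (2 + x) = (1 - x^2)^2"
        by (simp add: algebra_simps power2_eq_square)
      \<comment> \<open>Strictness comes from \<open>rho > 0\<close>: for positive x the gap closes
        only at x = 1.\<close>
      moreover have "x^2 \<noteq> 1" using x by (simp add: power2_eq_1_iff)
      then have "(1 - x^2)^2 > 0" by simp
      ultimately have "x * (1 + 2 * x) * (2 + x) < (1 + x + x^2)^2" by linarith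
      then have "sqrt (x * (1 + 2 * x) * (2 + x)) < 1 + x + x^2"
        using x by (intro real_less_lsqrt) auto
      moreover have "1 + x + x^2 > 0" using x by (intro add_pos_pos) auto
      ultimately show ?thesis by (simp add: theta_def)
    qed
    moreover have theta0: "theta > 0"
      using x by (auto simp: theta_def intro!: divide_pos_pos mult_pos_pos add_pos_pos)
    ultimately have lim: "(\<lambda>n. sqrt (real n) * theta ^ n) \<longlonglongrightarrow> 0"
      by real_asymp
    show "(\<lambda>n. (1 - x) / (sqrt (2 / pi) * sqrt x) * (sqrt (real n) * theta ^ n)) \<longlonglongrightarrow> 0"
      by (rule tendsto_mult_right_zero[OF lim])
    show "\<forall>\<^sub>F n in sequentially. loss_prob rho 1 n / g n
        \<le> (1 - x) / (sqrt (2 / pi) * sqrt x) * (sqrt (real n) * theta ^ n)"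
      using eventually_gt_at_top[of 0]
    proof eventually_elim
      case (elim n)
      \<comment> \<open>\<open>h\<close> is \<open>g n\<close> with \<open>x ^ m n\<close> lowered
        to x^((n+1)/2), using m \<le> (n+1)/2 and x < 1. This removes the parity, so the n-th powers
        cancel down to \<open>theta ^ n\<close>.\<close>
      define h where "h = sqrt (2 / pi) * (sqrt x * sqrt x ^ n) * 2 ^ n / (sqrt (real n) * (1 - x) * (1 + x) ^ n)"
      have "h > 0" using x elim by (simp add: h_def)
      have "sqrt x ^ (n + 1) \<le> sqrt x ^ (2 * m n)"
        by (rule power_decreasing) (use x in \<open>auto simp: m_def\<close>)
      then have le: "sqrt x * sqrt x ^ n \<le> x ^ m n" using x by (simp add: power_mult)
      have "h \<le> g n"
        unfolding h_def g using x le by (intro divide_right_mono mult_right_mono mult_left_mono) auto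
      have eq: "x^2 * (1 + 2 * x) * (2 + x) = x * (x * (1 + 2 * x) * (2 + x))"
        by (simp add: power2_eq_square)
      have "2 * sqrt (x^2 * (1 + 2 * x) * (2 + x)) / ((1 + x) * (1 + x + x^2)) =
          2 * sqrt x * theta / (1 + x)"
        unfolding theta_def eq real_sqrt_mult[of x "x * (1 + 2 * x) * (2 + x)"] by (simp add: mult_ac)
      then have "loss_prob rho 1 n \<le> (2 * sqrt x * theta / (1 + x)) ^ n"
        using loss_prob_1_le[OF assms, of n, folded x_def] by simp
      moreover have "(2 * sqrt x * theta / (1 + x)) ^ n > 0"
        using x theta0 by simp
      ultimately have "loss_prob rho 1 n / g n \<le> (2 * sqrt x * theta / (1 + x)) ^ n / h"
        using \<open>h > 0\<close> \<open>h \<le> g n\<close> by (intro frac_le) auto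
      also have "\<dots> = (1 - x) / (sqrt (2 / pi) * sqrt x) * (sqrt (real n) * theta ^ n)"
        unfolding h_def using x elim by (simp add: power_mult_distrib power_divide)
      finally show ?case .
    qed
  qed simp
  ultimately have "(\<lambda>n. loss_prob rho 2 n / g n + loss_prob rho 1 n / g n) \<longlonglongrightarrow> 1"
    using tendsto_add by fastforce
  then have upper: "(\<lambda>n. loss_prob rho 2 n + loss_prob rho 1 n) \<sim>[at_top] g"
    by (intro asymp_equivI') (simp add: add_divide_distrib)
  have lower: "loss_prob rho 2 \<sim>[at_top] g"
    by (intro asymp_equivI') fact
  show ?thesis
    unfolding g_def[symmetric]
    by (rule asymp_equiv_sandwich_real[OF lower upper])
       (auto intro!: always_eventually simp: one_minus_prob_cw3_bounds simp del: One_nat_def)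
qed

end
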